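(* Let $\zeta_{10}=e^{2\pi i/10}$, let $\mathcal{O}_{H_2}=\mathbb{Z}[\zeta_{10}]\subset\mathbb{C}$, and let $N(z)=z\bar z$. Then $$\mathcal{S}_1(\mathcal{O}_{H_2})=\{\zeta_{10}^k:0\le k\le 9\},$$ the regular decagon $H_2$ of cardinality $10$. The axis shell satisfies $\mathcal{A}(\mathcal{O}_{H_2})=\mathcal{S}_1(\mathcal{O}_{H_2}^{\,2})$ and is the non-crystallographic root-shell system $H_2\oplus H_2$ over $\mathbb{Z}[\varphi]$, of cardinality $20$, whose convex hull is the decagonal tegum $\{10\}\oplus\{10\}$.
   Context: $\varphi=(1+\sqrt5)/2$. For $\mathcal{O}\subset\mathbb{C}$ as in the claim, $\mathcal{S}_1(\mathcal{O})=\{z\in\mathcal{O}:N(z)=1\}$; the integral plane is $\mathcal{O}^2=\mathcal{O}\oplus\mathcal{O}\subset\mathbb{C}^2$ with quadratic form $Q(x,y)=N(x)+N(y)$ and $\mathcal{S}_1(\mathcal{O}^2)=\{(x,y)\in\mathcal{O}^2:Q(x,y)=1\}$; the axis shell is $\mathcal{A}(\mathcal{O})=(\mathcal{S}_1(\mathcal{O})\times\{0\})\cup(\{0\}\times\mathcal{S}_1(\mathcal{O}))$. $\mathbb{C}^2\cong\mathbb{R}^4$ carries the Euclidean structure with squared norm $Q$. A root-shell system over a ring $R\subset\mathbb{R}$ is a finite subset $T$ of a Euclidean space $V$ such that (R1) $T=-T$; (R2) $T$ lies on a single sphere $\{x: \mathcal N(x)=1\}$ for the Euclidean (squared) norm $\mathcal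 N$, so all elements have the same length; (R3) for each $\alpha\in T$ the reflection $r_\alpha(x)=x-\frac{2\langle x,\alpha\rangle}{\langle\alpha,\alpha\rangle}\alpha$ preserves $T$; (R4) the Cartan coefficients $\frac{2\langle\alpha,\beta\rangle}{\langle\alpha,\alpha\rangle}$ lie in $R$ for all $\alpha,\beta\in T$. For $R=\mathbb{Z}[\varphi]$ it is called non-crystallographic if some Cartan coefficient is not in $\mathbb{Z}$. $H_2$ is the root system of the dihedral Coxeter group $I_2(5)$: ten unit vectors at the vertices of a regular decagon. $H_2\oplus H_2$ is the orthogonal direct sum of two copies, i.e. $(T\times\{0\})\cup(\{0\}\times T)$ for $T$ of type $H_2$. $\{10\}$ is the regular decagon; for polytopes $P_1\subset V_1$, $P_2\subset V_2$ the free sum (tegum) is $P_1\oplus P_2=\mathrm{conv}\big((P_1\times\{0\})\cup(\{0\}\times P_2)\big)\subset V_1\oplus V_2$ with $V_1\perp V_2$. *)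

theory Defs
  imports
    "HOL-Analysis.Analysis"
    "HOL-Computational_Algebra.Polynomial"
    "HOL-Algebra.Bij"
    "HOL-Algebra.Generated_Groups"
    "HOL-Algebra.Multiplicative_Group"
begin

text \<open>The subring \<open>\<int>[a]\<close> generated by a ring element \<open>a\<close>, as the image of \<open>\<int>[X]\<close> under
  evaluation at \<open>a\<close>.\<close>

definition int_adjoin :: "'a::comm_ring_1 \<Rightarrow> 'a set" where
  "int_adjoin a = range (\<lambda>p :: int poly. poly (map_poly of_int p) a)"

definition golden :: real where
  "golden = (1 + sqrt 5) / 2"

definition zeta10 :: complex where
  "zeta10 = exp (2 * of_real pi * \<i> / 10)"

definition OH2 :: "complex set" where
  "OH2 = int_adjoin zeta10"

definition N :: "complex \<Rightarrow> complex" where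
  "N z = z * cnj z"

definition Q :: "complex \<times> complex \<Rightarrow> complex" where
  "Q = (\<lambda>(x, y). N x + N y)"

text \<open>The library's Euclidean structure on \<open>complex \<times> complex\<close> is the one with squared norm \<open>Q\<close>.\<close>

lemma Q_eq_norm_squared: "Q v = of_real ((norm v)\<^sup>2)"
  by (cases v) (simp add: Q_def N_def norm_Pair complex_norm_square[symmetric])

definition unit_shell :: "complex set \<Rightarrow> complex set" where
  "unit_shell R = {z \<in> R. N z = 1}"

definition plane_unit_shell :: "complex set \<Rightarrow> (complex \<times> complex) set" where
  "plane_unit_shell R = {v \<in> R \<times> R. Q v = 1}"

definition axis_sum :: "'a::zero set \<Rightarrow> 'b::zero set \<Rightarrow> ('a \<times> 'b) set" where
  "axis_sum A B = (A \<times> {0}) \<union> ({0} \<times> B)"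

definition axis_shell :: "complex set \<Rightarrow> (complex \<times> complex) set" where
  "axis_shell R = axis_sum (unit_shell R) (unit_shell R)"

definition cartan_coeff :: "'a::euclidean_space \<Rightarrow> 'a \<Rightarrow> real" where
  "cartan_coeff \<alpha> \<beta> = 2 * inner \<alpha> \<beta> / inner \<alpha> \<alpha>"

definition root_reflection :: "'a::euclidean_space \<Rightarrow> 'a \<Rightarrow> 'a" where
  "root_reflection \<alpha> x = x - (2 * inner x \<alpha> / inner \<alpha> \<alpha>) *\<^sub>R \<alpha>"

definition real_subring :: "real set \<Rightarrow> bool" where
  "real_subring R \<longleftrightarrow> 1 \<in> R \<and> (\<forall>x\<in>R. \<forall>y\<in>R. x - y \<in> R \<and> x * y \<in> R)"

definition root_shell_system :: "real set \<Rightarrow> 'a::euclidean_space set \<Rightarrow> bool" where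
  "root_shell_system R T \<longleftrightarrow>
     real_subring R \<and> finite T \<and>
     uminus ` T = T \<and>
     (\<forall>\<alpha>\<in>T. (norm \<alpha>)\<^sup>2 = 1) \<and>
     (\<forall>\<alpha>\<in>T. root_reflection \<alpha> ` T = T) \<and>
     (\<forall>\<alpha>\<in>T. \<forall>\<beta>\<in>T. cartan_coeff \<alpha> \<beta> \<in> R)"

definition noncrystallographic_root_shell_system :: "'a::euclidean_space set \<Rightarrow> bool" where
  "noncrystallographic_root_shell_system T \<longleftrightarrow>
     root_shell_system (int_adjoin golden) T \<and>
     (\<exists>\<alpha>\<in>T. \<exists>\<beta>\<in>T. cartan_coeff \<alpha> \<beta> \<notin> \<int>)"

definition reflection_group :: "'a::euclidean_space set \<Rightarrow> ('a \<Rightarrow> 'a) set" where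
  "reflection_group T = generate (BijGroup UNIV) (root_reflection ` T)"

text \<open>A set of bijections is a Coxeter group of type \<open>I\<^sub>2(m)\<close> if it is generated by two
  involutions whose product has order \<open>m\<close>.\<close>

definition dihedral_coxeter :: "nat \<Rightarrow> ('a \<Rightarrow> 'a) set \<Rightarrow> bool" where
  "dihedral_coxeter m W \<longleftrightarrow>
     (\<exists>s\<in>carrier (BijGroup UNIV). \<exists>t\<in>carrier (BijGroup UNIV).
        group.ord (BijGroup UNIV) s = 2 \<and>
        group.ord (BijGroup UNIV) t = 2 \<and>
        group.ord (BijGroup UNIV) (s \<otimes>\<^bsub>BijGroup UNIV\<^esub> t) = m \<and>
        W = generate (BijGroup UNIV) {s, t})"

definition regular_polygon_vertices :: "nat \<Rightarrow> complex set" where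
  "regular_polygon_vertices n = (\<lambda>k. cis (2 * pi * real k / real n)) ` {..<n}"

definition regular_polygon :: "nat \<Rightarrow> complex set" where
  "regular_polygon n = convex hull (regular_polygon_vertices n)"

text \<open>Being of type \<open>H\<^sub>2\<close>, for subsets of the Euclidean plane: ten unit vectors at the vertices of
  a regular decagon (in any position about the origin), with reflection group \<open>I\<^sub>2(5)\<close>.\<close>

definition is_H2 :: "complex set \<Rightarrow> bool" where
  "is_H2 T \<longleftrightarrow>
     (\<exists>f. orthogonal_transformation f \<and> T = f ` regular_polygon_vertices 10) \<and>
     dihedral_coxeter 5 (reflection_group T)"

definition is_H2_plus_H2 :: "(complex \<times> complex) set \<Rightarrow> bool" where
  "is_H2_plus_H2 X \<longleftrightarrow> (\<exists>T. is_H2 T \<and> X = axis_sum T T)"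

definition tegum :: "'a::euclidean_space set \<Rightarrow> 'b::euclidean_space set \<Rightarrow> ('a \<times> 'b) set" where
  "tegum P\<^sub>1 P\<^sub>2 = convex hull (axis_sum P\<^sub>1 P\<^sub>2)"

end

theory Submission imports Defs begin

text \<open>
  Write \<open>\<zeta>\<close> for \<open>zeta10\<close>. Since \<open>\<zeta> + cnj \<zeta>\<close> is the golden ratio \<open>\<phi>\<close>, expanding \<open>z * cnj z\<close> for
  \<open>z = a + b \<zeta> + c \<zeta>\<^sup>2 + d \<zeta>\<^sup>3\<close> gives \<open>N z = q + r * \<phi>\<close>, where \<open>q\<close> and \<open>r\<close> are integral
  quadratic forms in \<open>a, b, c, d\<close> (\<open>N_zeta10_comb\<close>). The point of the proof is that \<open>q\<close> is the
  positive definite form of the root lattice \<open>A\<^sub>4\<close>, half a sum of five squares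
  (\<open>A4_form_sum_squares\<close>), although the norm form itself takes arbitrarily small values on the
  dense ring \<open>\<int>[\<zeta>]\<close>. As \<open>\<phi>\<close> is irrational, an equation in \<open>\<int>[\<phi>]\<close> can be read off coefficientwise.

  \<^item> \<open>N z = 1\<close> means \<open>q = 1\<close> and \<open>r = 0\<close>. The condition \<open>q = 1\<close> leaves the \<open>20\<close> roots of \<open>A\<^sub>4\<close>,
    and \<open>r = 0\<close> selects ten of them, which are the powers of \<open>\<zeta>\<close> (\<open>unit_shell_OH2\<close>).

  \<^item> \<open>N x + N y = 1\<close> forces the nonnegative integers \<open>q x\<close> and \<open>q y\<close> to have sum \<open>1\<close>, so one of
    them vanishes, and by definiteness so does \<open>x\<close> or \<open>y\<close>
    (\<open>axis_shell_eq_plane_unit_shell\<close>).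

  The unit shell is thus the group of tenth roots of unity. For a unit complex number \<open>\<alpha>\<close>, the
  reflection in \<open>\<alpha>\<close> is \<open>x \<mapsto> - \<alpha>\<^sup>2 * cnj x\<close> and the Cartan coefficient with \<open>\<beta>\<close> is the trace of
  \<open>\<alpha> * cnj \<beta>\<close>. This turns the root shell axioms into closure properties of the group, makes every
  Cartan coefficient an element of \<open>\<int>[\<phi>]\<close> (\<open>twice_Re_OH2\<close>), and shows that the reflection
  group is generated by two reflections whose product is the rotation \<open>\<zeta>\<^sup>2\<close> of order \<open>5\<close>. The root
  shell axioms pass to orthogonal sums (\<open>root_shell_system_axis_sum\<close>), and a free sum of convex
  hulls is the convex hull of the axis sum (\<open>tegum_convex_hulls\<close>).
\<close>

section \<open>Adjoining an element to the integers\<close>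

lemma map_poly_of_int_diff:
  "map_poly (of_int :: int \<Rightarrow> 'a::comm_ring_1) (p - q) = map_poly of_int p - map_poly of_int q"
  by (rule poly_eqI) (simp add: coeff_map_poly)

lemma map_poly_of_int_mult:
  "map_poly (of_int :: int \<Rightarrow> 'a::comm_ring_1) (p * q) = map_poly of_int p * map_poly of_int q"
  by (rule poly_eqI) (simp add: coeff_map_poly coeff_mult)

lemma int_adjoin_diff: "x \<in> int_adjoin a \<Longrightarrow> y \<in> int_adjoin a \<Longrightarrow> x - y \<in> int_adjoin a"
  unfolding int_adjoin_def by (metis (no_types, lifting) map_poly_of_int_diff poly_diff rangeE rangeI)

lemma int_adjoin_mult: "x \<in> int_adjoin a \<Longrightarrow> y \<in> int_adjoin a \<Longrightarrow> x * y \<in> int_adjoin a"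
  unfolding int_adjoin_def by (metis (no_types, lifting) map_poly_of_int_mult poly_mult rangeE rangeI)

lemma int_adjoin_linear: "of_int m + of_int n * a \<in> int_adjoin a"
  unfolding int_adjoin_def
  by (rule range_eqI[of _ _ "[:m, n:]"]) (simp add: map_poly_pCons mult.commute)

lemma int_adjoin_one: "1 \<in> int_adjoin a"
  using int_adjoin_linear[of 1 0 a] by simp

lemma int_adjoin_zero: "0 \<in> int_adjoin a"
  using int_adjoin_linear[of 0 0 a] by simp

lemma int_adjoin_power: "a ^ k \<in> int_adjoin a"
proof (induction k)
  case 0
  show ?case by (simp add: int_adjoin_one)
next
  case (Suc k)
  then show ?case using int_adjoin_mult[OF int_adjoin_linear[of 0 1 a] Suc] by simp
qed

lemma real_subring_int_adjoin: "real_subring (int_adjoin a)"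
  by (simp add: real_subring_def int_adjoin_one int_adjoin_diff int_adjoin_mult)

section \<open>The golden ratio and the tenth root of unity\<close>

lemma golden_squared: "golden\<^sup>2 = golden + 1"
  by (simp add: golden_def power2_eq_square field_simps)

lemma golden_notin_Ints: "golden \<notin> \<int>"
proof
  assume "golden \<in> \<int>"
  then obtain n :: int where n: "golden = of_int n" by (auto elim: Ints_cases)
  have "2 < sqrt 5" "sqrt 5 < 3"
    by (auto intro: real_less_rsqrt real_less_lsqrt)
  then have "1 < golden" "golden < 2"
    by (auto simp: golden_def)
  then have "1 < n" "n < 2" by (simp_all add: n)
  then show False by linarith
qed

text \<open>The golden ratio is a root of the monic polynomial \<open>X\<^sup>2 - X - 1\<close>, so if it were rational it would
  be an integer; but it lies strictly between \<open>1\<close> and \<open>2\<close>.\<close>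

lemma golden_irrational: "golden \<notin> \<rat>"
proof
  assume "golden \<in> \<rat>"
  moreover have "algebraic_int golden"
    by (rule algebraic_int.intros[of "[:-1, -1, 1:]"])
      (use golden_squared in \<open>auto simp: coeff_pCons power2_eq_square algebra_simps split: nat.splits\<close>)
  ultimately show False
    using rational_algebraic_int_is_int golden_notin_Ints by blast
qed

text \<open>Comparing coefficients of \<open>1\<close> and \<open>golden\<close>: an integral equation over \<open>\<int>[golden]\<close> is two
  equations over the integers.\<close>

lemma golden_coords_unique:
  assumes "of_int m + of_int n * golden = (of_int k :: real)"
  shows "m = k \<and> n = 0"
proof -
  have "n = 0"
  proof (rule ccontr)
    assume "n \<noteq> 0"
    then have "golden = (of_int (k - m)) / of_int n"
      using assms by (simp add: field_simps)
    then have "golden \<in> \<rat>" by (metis Rats_divide Rats_of_int)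
    then show False using golden_irrational by simp
  qed
  then show ?thesis using assms by simp
qed

lemma zeta10_eq_cis: "zeta10 = cis (pi / 5)"
  by (simp add: zeta10_def cis_conv_exp mult.commute)

lemma zeta10_power_eq_cis: "zeta10 ^ k = cis (2 * pi * real k / real 10)"
  by (simp add: zeta10_eq_cis Complex.DeMoivre field_simps)

lemma zeta10_power5: "zeta10 ^ 5 = -1"
  by (simp add: zeta10_power_eq_cis)

lemma norm_zeta10 [simp]: "norm zeta10 = 1"
  by (simp add: zeta10_eq_cis)

lemma zeta10_cnj: "zeta10 * cnj zeta10 = 1"
  by (simp add: complex_norm_square[symmetric])

lemma zeta10_neq_minus1: "zeta10 \<noteq> -1"
proof -
  have "0 < cos (pi / 5)" by (rule cos_gt_zero) auto
  then have "0 < Re zeta10" by (simp add: zeta10_eq_cis)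
  then show ?thesis by (metis less_asym neg_less_0_iff_less one_complex.sel(1) uminus_complex.sel(1) zero_less_one)
qed

text \<open>The tenth cyclotomic relation, from \<open>X\<^sup>5 + 1 = (X + 1) * (X\<^sup>4 - X\<^sup>3 + X\<^sup>2 - X + 1)\<close>.\<close>

lemma zeta10_power4: "zeta10 ^ 4 = zeta10 ^ 3 - zeta10 ^ 2 + zeta10 - 1"
proof -
  have "(zeta10 + 1) * (zeta10 ^ 4 - (zeta10 ^ 3 - zeta10 ^ 2 + zeta10 - 1)) = zeta10 ^ 5 + 1"
    by (simp add: algebra_simps eval_nat_numeral)
  then have "(zeta10 + 1) * (zeta10 ^ 4 - (zeta10 ^ 3 - zeta10 ^ 2 + zeta10 - 1)) = 0"
    by (simp add: zeta10_power5)
  moreover have "zeta10 + 1 \<noteq> 0"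
    using zeta10_neq_minus1 by (simp add: eq_neg_iff_add_eq_0)
  ultimately show ?thesis by simp
qed

text \<open>The trace \<open>t = 2 * cos (pi / 5)\<close> satisfies \<open>t\<^sup>2 = t + 1\<close> because \<open>zeta10\<close> satisfies its quartic
  equation; the other root of that quadratic is negative.\<close>

lemma zeta10_trace: "zeta10 + cnj zeta10 = of_real golden"
proof -
  define t where "t = 2 * cos (pi / 5)"
  have T: "zeta10 + cnj zeta10 = of_real t"
    by (simp add: t_def zeta10_eq_cis complex_eq_iff)
  \<comment> \<open>Dividing the quartic equation of \<open>zeta10\<close> by \<open>zeta10\<^sup>2\<close> leaves \<open>t\<^sup>2 = t + 1\<close>. The
    division is multiplication by the square of the conjugate, hence the correction term that
    vanishes where \<open>z * w = 1\<close>.\<close>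
  have expand: "w\<^sup>2 * (z ^ 4 - (z ^ 3 - z\<^sup>2 + z - 1))
      = (z + w)\<^sup>2 - (z + w) - 1 + (z * w - 1) * (z * w * z * z + z * z - z * (z * w) - z + z * w - w - 1)"
    for z w :: complex
    by (simp add: power2_eq_square power3_eq_cube power4_eq_xxxx algebra_simps)
  have "(of_real t)\<^sup>2 = (of_real t + 1 :: complex)"
    using expand[of "cnj zeta10" zeta10] by (simp add: zeta10_power4 zeta10_cnj T diff_eq_eq add.commute)
  then have "of_real (t\<^sup>2) = (of_real (t + 1) :: complex)" by simp
  then have "t\<^sup>2 = t + 1" by (simp only: of_real_eq_iff)
  then have "(t - golden) * (t - (1 - golden)) = 0"
    using golden_squared by (simp add: algebra_simps power2_eq_square)
  moreover have "0 < t"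
    unfolding t_def by (simp add: cos_gt_zero)
  moreover have "1 - golden < 0"
    by (simp add: golden_def)
  ultimately have "t = golden" by auto
  then show ?thesis using T by simp
qed

lemma zeta10_powers_eq_roots: "{zeta10 ^ k | k. k < 10} = {z. z ^ 10 = 1}"
  using bij_betw_imp_surj_on[OF Complex.bij_betw_roots_unity[of 10]]
  by (auto simp: zeta10_power_eq_cis image_iff set_eq_iff)

lemma zeta10_power_eq_1_iff: "zeta10 ^ k = 1 \<longleftrightarrow> 10 dvd k"
proof -
  have p10: "zeta10 ^ 10 = 1"
    using zeta10_power5 power_mult[of zeta10 5 2] by simp
  have "zeta10 ^ k = zeta10 ^ (10 * (k div 10) + k mod 10)" by simp
  also have "\<dots> = zeta10 ^ (k mod 10)"
    unfolding power_add power_mult p10 by simp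
  finally have red: "zeta10 ^ k = zeta10 ^ (k mod 10)" .
  have inj: "inj_on (\<lambda>k. zeta10 ^ k) {..<10}"
    using bij_betw_imp_inj_on[OF Complex.bij_betw_roots_unity[of 10]]
    by (simp add: zeta10_power_eq_cis)
  have "zeta10 ^ (k mod 10) = zeta10 ^ 0 \<longleftrightarrow> k mod 10 = 0"
    using inj_on_eq_iff[OF inj, of "k mod 10" 0] by simp
  then show ?thesis using red by (simp add: dvd_eq_mod_eq_0)
qed

section \<open>The norm form in coordinates\<close>

text \<open>The quartic relation of \<open>zeta10\<close> makes the first four powers span \<open>\<int>[zeta10]\<close> over the
  integers, so that \<open>OH2\<close> is parametrised by integer quadruples.\<close>

definition zeta10_comb :: "int \<Rightarrow> int \<Rightarrow> int \<Rightarrow> int \<Rightarrow> complex" where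
  "zeta10_comb a b c d =
     of_int a + of_int b * zeta10 + of_int c * zeta10\<^sup>2 + of_int d * zeta10 ^ 3"

lemma OH2_coords:
  assumes "z \<in> OH2"
  obtains a b c d where "z = zeta10_comb a b c d"
proof -
  have "\<exists>a b c d. poly (map_poly of_int p) zeta10 = zeta10_comb a b c d" for p :: "int poly"
  proof (induction p)
    case 0
    show ?case by (rule exI[of _ 0])+ (simp add: zeta10_comb_def)
  next
    case (pCons m p)
    then obtain a b c d where "poly (map_poly of_int p) zeta10 = zeta10_comb a b c d"
      by blast
    \<comment> \<open>Horner's step: multiplication by \<open>zeta10\<close> shifts the coordinates, and the quartic relation
      returns the overflowing coefficient \<open>d\<close> to all four places.\<close>
    moreover have "of_int m + zeta10 * zeta10_comb a b c d
        = zeta10_comb (m - d) (a + d) (b - d) (c + d)"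
    proof -
      have "of_int m + zeta10 * zeta10_comb a b c d
          = of_int m + of_int a * zeta10 + of_int b * zeta10\<^sup>2 + of_int c * zeta10 ^ 3 + of_int d * zeta10 ^ 4"
        by (simp add: zeta10_comb_def algebra_simps power2_eq_square power3_eq_cube power4_eq_xxxx)
      also have "\<dots> = zeta10_comb (m - d) (a + d) (b - d) (c + d)"
        unfolding zeta10_power4 zeta10_comb_def by (simp add: algebra_simps)
      finally show ?thesis .
    qed
    ultimately have "poly (map_poly of_int (pCons m p)) zeta10
        = zeta10_comb (m - d) (a + d) (b - d) (c + d)"
      by (simp add: map_poly_pCons)
    then show ?case by blast
  qed
  then show ?thesis
    using assms that unfolding OH2_def int_adjoin_def by blast
qed

text \<open>Up to signs of the coordinates this is half the quadratic form of the Cartan matrix of type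
  \<open>A\<^sub>4\<close>: the mixed terms link the coordinates along the path \<open>c - a - d - b\<close>.\<close>

definition A4_form :: "int \<Rightarrow> int \<Rightarrow> int \<Rightarrow> int \<Rightarrow> int" where
  "A4_form a b c d = a\<^sup>2 + b\<^sup>2 + c\<^sup>2 + d\<^sup>2 - a * c - b * d + a * d"

text \<open>The coefficient of \<open>golden\<close> in the norm of \<open>zeta10_comb a b c d\<close>.\<close>

definition golden_form :: "int \<Rightarrow> int \<Rightarrow> int \<Rightarrow> int \<Rightarrow> int" where
  "golden_form a b c d = a * b + b * c + c * d + a * c + b * d - a * d"

lemma zeta10_power_traces:
  "zeta10\<^sup>2 + (cnj zeta10)\<^sup>2 = of_real golden - 1"
  "zeta10 ^ 3 + (cnj zeta10) ^ 3 = 1 - of_real golden"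
proof -
  define g where "g = (of_real golden :: complex)"
  have g2: "g * g = g + 1"
    using arg_cong[OF golden_squared, of "of_real :: real \<Rightarrow> complex"]
    by (simp add: g_def power2_eq_square)
  have tr: "zeta10 + cnj zeta10 = g" by (simp add: zeta10_trace g_def)
  have "zeta10\<^sup>2 + (cnj zeta10)\<^sup>2
      = (zeta10 + cnj zeta10) * (zeta10 + cnj zeta10) - 2 * (zeta10 * cnj zeta10)"
    by (simp add: power2_eq_square algebra_simps)
  also have "\<dots> = g - 1" unfolding zeta10_cnj tr g2 by simp
  finally show tr2: "zeta10\<^sup>2 + (cnj zeta10)\<^sup>2 = of_real golden - 1" by (simp only: g_def)
  have "zeta10 ^ 3 + (cnj zeta10) ^ 3
      = (zeta10 + cnj zeta10) * (zeta10\<^sup>2 + (cnj zeta10)\<^sup>2 - zeta10 * cnj zeta10)"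
    by (simp add: power2_eq_square power3_eq_cube algebra_simps)
  also have "\<dots> = g * g - 2 * g" unfolding zeta10_cnj tr tr2 g_def by (simp add: algebra_simps)
  also have "\<dots> = 1 - g" unfolding g2 by simp
  finally show "zeta10 ^ 3 + (cnj zeta10) ^ 3 = 1 - of_real golden" by (simp only: g_def)
qed

text \<open>By \<open>zeta10 * cnj zeta10 = 1\<close>, the product of powers \<open>i\<close> and \<open>j\<close> in \<open>z * cnj z\<close> depends only on
  their difference, and the three traces that occur are \<open>golden\<close>, \<open>golden - 1\<close> and \<open>1 - golden\<close>.\<close>

lemma N_zeta10_comb:
  "N (zeta10_comb a b c d)
     = of_real (of_int (A4_form a b c d) + of_int (golden_form a b c d) * golden)"
proof -
  have expand: "(A + B * z + C * z\<^sup>2 + D * z ^ 3) * (A + B * w + C * w\<^sup>2 + D * w ^ 3)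
      = A\<^sup>2 + B\<^sup>2 * (z * w) + C\<^sup>2 * (z * w)\<^sup>2 + D\<^sup>2 * (z * w) ^ 3
        + (A * B + B * C * (z * w) + C * D * (z * w)\<^sup>2) * (z + w)
        + (A * C + B * D * (z * w)) * (z\<^sup>2 + w\<^sup>2) + A * D * (z ^ 3 + w ^ 3)"
    for A B C D z w :: complex
    by (simp add: algebra_simps power2_eq_square power3_eq_cube)
  have "N (zeta10_comb a b c d)
      = (of_int a + of_int b * zeta10 + of_int c * zeta10\<^sup>2 + of_int d * zeta10 ^ 3)
        * (of_int a + of_int b * cnj zeta10 + of_int c * (cnj zeta10)\<^sup>2 + of_int d * (cnj zeta10) ^ 3)"
    by (simp add: N_def zeta10_comb_def)
  then show ?thesis
    unfolding expand zeta10_cnj zeta10_trace zeta10_power_traces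
    by (simp add: A4_form_def golden_form_def algebra_simps)
qed

text \<open>The five squares are those of the standard model of \<open>A\<^sub>4\<close> as the integer vectors of length five
  with coordinate sum zero: \<open>-c\<close>, \<open>c - a\<close>, \<open>a + d\<close>, \<open>b - d\<close> and \<open>-b\<close> add up to zero.\<close>

lemma A4_form_sum_squares:
  "2 * A4_form a b c d = c\<^sup>2 + (c - a)\<^sup>2 + (a + d)\<^sup>2 + (d - b)\<^sup>2 + b\<^sup>2"
  by (simp add: A4_form_def power2_eq_square algebra_simps)

lemma A4_form_nonneg: "0 \<le> A4_form a b c d"
proof -
  have "0 \<le> 2 * A4_form a b c d"
    unfolding A4_form_sum_squares by simp
  then show ?thesis by simp
qed

lemma A4_form_eq_0:
  assumes "A4_form a b c d = 0"
  shows "a = 0 \<and> b = 0 \<and> c = 0 \<and> d = 0"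
proof -
  have *: "c\<^sup>2 + (c - a)\<^sup>2 + (a + d)\<^sup>2 + (d - b)\<^sup>2 + b\<^sup>2 = 0"
    using A4_form_sum_squares[of a b c d] assms by simp
  have "c\<^sup>2 \<ge> 0" "(c - a)\<^sup>2 \<ge> 0" "(a + d)\<^sup>2 \<ge> 0" "(d - b)\<^sup>2 \<ge> 0" "b\<^sup>2 \<ge> 0" by simp_all
  then have "c\<^sup>2 = 0" "(c - a)\<^sup>2 = 0" "(d - b)\<^sup>2 = 0" "b\<^sup>2 = 0" using * by linarith+
  then show ?thesis by simp
qed

lemma zeta10_comb_eq_0:
  assumes "A4_form a b c d = 0"
  shows "zeta10_comb a b c d = 0"
  using A4_form_eq_0[OF assms] by (simp add: zeta10_comb_def)

text \<open>The five squares sum to \<open>2\<close>, so each is at most \<open>1\<close>. Four of them determine the quadruple, which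
  leaves \<open>3\<^sup>4\<close> candidates; the survivors are the coordinates of \<open>\<plusminus> zeta10 ^ k\<close> for \<open>k \<le> 4\<close>.\<close>

lemma unit_norm_coords:
  assumes "A4_form a b c d = 1" "golden_form a b c d = 0"
  shows "(a, b, c, d) \<in> {(1,0,0,0), (0,1,0,0), (0,0,1,0), (0,0,0,1), (-1,1,-1,1),
    (-1,0,0,0), (0,-1,0,0), (0,0,-1,0), (0,0,0,-1), (1,-1,1,-1)}"
proof -
  have small: "x \<in> {-1, 0, 1}" if "x\<^sup>2 \<le> 2" for x :: int
  proof -
    have "\<bar>x\<bar> < 2"
      using that power_mono[of 2 "\<bar>x\<bar>" 2] by fastforce
    then show ?thesis by auto
  qed
  have *: "c\<^sup>2 + (c - a)\<^sup>2 + (a + d)\<^sup>2 + (d - b)\<^sup>2 + b\<^sup>2 = 2"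
    using A4_form_sum_squares[of a b c d] assms by simp
  have "c\<^sup>2 \<ge> 0" "(c - a)\<^sup>2 \<ge> 0" "(a + d)\<^sup>2 \<ge> 0" "(d - b)\<^sup>2 \<ge> 0" "b\<^sup>2 \<ge> 0" by simp_all
  then have "c\<^sup>2 \<le> 2" "(c - a)\<^sup>2 \<le> 2" "(d - b)\<^sup>2 \<le> 2" "b\<^sup>2 \<le> 2"
    using * by linarith+
  then have "c \<in> {-1, 0, 1}" "c - a \<in> {-1, 0, 1}" "d - b \<in> {-1, 0, 1}" "b \<in> {-1, 0, 1}"
    using small by blast+
  then have "c \<in> {-1, 0, 1}" "a \<in> {c + 1, c, c - 1}" "b \<in> {-1, 0, 1}" "d \<in> {b - 1, b, b + 1}"
    by auto
  then show ?thesis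
    using assms unfolding A4_form_def golden_form_def by (elim insertE emptyE; simp)
qed

section \<open>The unit shells\<close>

lemma unit_shell_OH2: "unit_shell OH2 = {z. z ^ 10 = 1}"
proof (intro equalityI subsetI)
  fix z assume "z \<in> unit_shell OH2"
  then have zO: "z \<in> OH2" and "N z = 1" by (auto simp: unit_shell_def)
  then obtain a b c d where z: "z = zeta10_comb a b c d" by (elim OH2_coords)
  have "of_int (A4_form a b c d) + of_int (golden_form a b c d) * golden = of_int 1"
    using \<open>N z = 1\<close> unfolding z N_zeta10_comb by (simp add: of_real_eq_1_iff del: of_real_add)
  then have "A4_form a b c d = 1" "golden_form a b c d = 0"
    using golden_coords_unique by blast+
  then have "(a, b, c, d) \<in> {(1,0,0,0), (0,1,0,0), (0,0,1,0), (0,0,0,1), (-1,1,-1,1),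
    (-1,0,0,0), (0,-1,0,0), (0,0,-1,0), (0,0,0,-1), (1,-1,1,-1)}"
    by (rule unit_norm_coords)
  then have "z \<in> {zeta10 ^ 0, zeta10 ^ 1, zeta10 ^ 2, zeta10 ^ 3, zeta10 ^ 4,
      - (zeta10 ^ 0), - (zeta10 ^ 1), - (zeta10 ^ 2), - (zeta10 ^ 3), - (zeta10 ^ 4)}"
    unfolding z zeta10_comb_def zeta10_power4 by (elim insertE emptyE; simp)
  then obtain k where "z = zeta10 ^ k \<or> z = - (zeta10 ^ k)" by blast
  then have "z ^ 10 = (zeta10 ^ 10) ^ k"
    by (auto simp flip: power_mult simp: mult.commute)
  also have "\<dots> = 1" using zeta10_power_eq_1_iff[of 10] by simp
  finally show "z \<in> {z. z ^ 10 = 1}" by simp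
next
  fix z :: complex assume "z \<in> {z. z ^ 10 = 1}"
  then obtain k where z: "z = zeta10 ^ k"
    using zeta10_powers_eq_roots by blast
  have "N z = 1"
    unfolding N_def z complex_norm_square[symmetric] by (simp add: norm_power)
  moreover have "z \<in> OH2"
    by (simp add: z OH2_def int_adjoin_power)
  ultimately show "z \<in> unit_shell OH2" by (simp add: unit_shell_def)
qed

lemma axis_shell_eq_plane_unit_shell: "axis_shell OH2 = plane_unit_shell OH2"
proof (intro equalityI subsetI)
  fix v assume "v \<in> axis_shell OH2"
  moreover have "0 \<in> OH2" by (simp add: OH2_def int_adjoin_zero)
  ultimately show "v \<in> plane_unit_shell OH2"
    by (auto simp: axis_shell_def axis_sum_def plane_unit_shell_def unit_shell_def Q_def N_def)
next
  fix v assume v: "v \<in> plane_unit_shell OH2"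
  obtain x y where xy: "v = (x, y)" by (cases v)
  have O: "x \<in> OH2" "y \<in> OH2" and Q: "N x + N y = 1"
    using v by (auto simp: xy plane_unit_shell_def Q_def)
  obtain a b c d where x: "x = zeta10_comb a b c d" using O(1) by (elim OH2_coords)
  obtain a' b' c' d' where y: "y = zeta10_comb a' b' c' d'" using O(2) by (elim OH2_coords)
  have "of_real (of_int (A4_form a b c d + A4_form a' b' c' d')
      + of_int (golden_form a b c d + golden_form a' b' c' d') * golden) = (1 :: complex)"
    using Q unfolding x y N_zeta10_comb by (simp add: algebra_simps)
  then have "of_int (A4_form a b c d + A4_form a' b' c' d')
      + of_int (golden_form a b c d + golden_form a' b' c' d') * golden = of_int 1"
    unfolding of_real_eq_1_iff by simp
  then have "A4_form a b c d + A4_form a' b' c' d' = 1"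
    using golden_coords_unique by blast
  then have "A4_form a b c d = 0 \<or> A4_form a' b' c' d' = 0"
    using A4_form_nonneg[of a b c d] A4_form_nonneg[of a' b' c' d'] by linarith
  then have "x = 0 \<or> y = 0"
    unfolding x y by (metis zeta10_comb_eq_0)
  then show "v \<in> axis_shell OH2"
  proof
    assume "x = 0"
    then show ?thesis
      using O Q by (simp add: xy axis_shell_def axis_sum_def unit_shell_def N_def)
  next
    assume "y = 0"
    then show ?thesis
      using O Q by (simp add: xy axis_shell_def axis_sum_def unit_shell_def N_def)
  qed
qed

section \<open>Root shells\<close>

lemma card_axis_sum:
  fixes A :: "'a::zero set" and B :: "'b::zero set"
  assumes "finite A" "finite B" "0 \<notin> A"
  shows "card (axis_sum A B) = card A + card B"
proof -
  have "(A \<times> {0}) \<inter> ({0} \<times> B) = ({} :: ('a \<times> 'b) set)"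
    using assms(3) by auto
  then show ?thesis
    using assms by (simp add: axis_sum_def card_Un_disjoint card_cartesian_product)
qed

lemma root_reflection_axes:
  "root_reflection (a, 0) (x, 0) = (root_reflection a x, 0)"
  "root_reflection (a, 0) (0, y) = (0, y)"
  "root_reflection (0, b) (x, 0) = (x, 0)"
  "root_reflection (0, b) (0, y) = (0, root_reflection b y)"
  by (simp_all add: root_reflection_def)

text \<open>A reflection in a root of one summand acts on that summand and fixes the other pointwise, and
  roots of different summands are orthogonal, so that their Cartan coefficient is zero.\<close>

lemma root_shell_system_axis_sum:
  assumes A: "root_shell_system R A" and B: "root_shell_system R B"
  shows "root_shell_system R (axis_sum A B)"
proof -
  have "1 - 1 \<in> R" using A unfolding root_shell_system_def real_subring_def by blast
  then have R0: "0 \<in> R" by simp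
  have neg: "uminus ` axis_sum S T = axis_sum (uminus ` S) (uminus ` T)" for S :: "'a set" and T :: "'b set"
    unfolding axis_sum_def by force
  have refl1: "root_reflection (a, 0) ` axis_sum A B = axis_sum (root_reflection a ` A) B" for a
  proof -
    have "root_reflection (a, 0) ` (A \<times> {0}) = (root_reflection a ` A) \<times> ({0} :: 'b set)"
      "root_reflection (a, 0) ` ({0} \<times> B) = ({0} :: 'a set) \<times> B"
      by (force simp: root_reflection_axes)+
    then show ?thesis by (simp add: axis_sum_def image_Un)
  qed
  have refl2: "root_reflection (0, b) ` axis_sum A B = axis_sum A (root_reflection b ` B)" for b
  proof -
    have "root_reflection (0, b) ` (A \<times> {0}) = A \<times> ({0} :: 'b set)"
      "root_reflection (0, b) ` ({0} \<times> B) = ({0} :: 'a set) \<times> (root_reflection b ` B)"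
      by (force simp: root_reflection_axes)+
    then show ?thesis by (simp add: axis_sum_def image_Un)
  qed
  have cases: "v \<in> axis_sum A B \<Longrightarrow> (\<exists>a\<in>A. v = (a, 0)) \<or> (\<exists>b\<in>B. v = (0, b))" for v
    by (auto simp: axis_sum_def)
  show ?thesis
    unfolding root_shell_system_def
  proof (intro conjI ballI)
    show "real_subring R" using A by (simp add: root_shell_system_def)
    show "finite (axis_sum A B)"
      using A B by (simp add: root_shell_system_def axis_sum_def)
    show "uminus ` axis_sum A B = axis_sum A B"
      using A B by (simp add: root_shell_system_def neg)
  next
    fix v assume "v \<in> axis_sum A B"
    then show "(norm v)\<^sup>2 = 1"
      using A B by (auto dest!: cases simp: root_shell_system_def norm_Pair)
  next
    fix v assume "v \<in> axis_sum A B"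
    then have "(\<exists>a\<in>A. v = (a, 0)) \<or> (\<exists>b\<in>B. v = (0, b))" by (rule cases)
    moreover have "\<forall>a\<in>A. root_reflection a ` A = A" "\<forall>b\<in>B. root_reflection b ` B = B"
      using A B by (simp_all add: root_shell_system_def)
    ultimately show "root_reflection v ` axis_sum A B = axis_sum A B"
      by (elim disjE bexE) (simp_all add: refl1 refl2)
  next
    fix v w assume "v \<in> axis_sum A B" "w \<in> axis_sum A B"
    then show "cartan_coeff v w \<in> R"
      using A B R0 by (auto dest!: cases simp: root_shell_system_def cartan_coeff_def)
  qed
qed

text \<open>Substituting \<open>2 * inner x a = x * cnj a + cnj x * a\<close> into the reflection formula cancels \<open>x\<close>.
  In this form, invariance of a group of roots of unity containing \<open>-1\<close> is immediate.\<close>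

lemma root_reflection_unit_complex:
  fixes a x :: complex
  assumes "norm a = 1"
  shows "root_reflection a x = - (a\<^sup>2 * cnj x)"
proof -
  have n: "a * cnj a = 1" using assms by (simp add: complex_norm_square[symmetric])
  have i: "inner a a = 1" using assms by (simp add: norm_eq_1)
  have "of_real (2 * inner x a) = x * cnj a + cnj x * a"
    by (simp add: complex_eq_iff inner_complex_def)
  then have "root_reflection a x = x - (x * cnj a + cnj x * a) * a"
    by (simp add: root_reflection_def i scaleR_conv_of_real)
  also have "\<dots> = x * (1 - a * cnj a) - a\<^sup>2 * cnj x"
    by (simp add: power2_eq_square algebra_simps)
  also have "\<dots> = - (a\<^sup>2 * cnj x)" by (simp add: n)
  finally show ?thesis .
qed

text \<open>The trace \<open>z + cnj z\<close> is additive, and the traces of the four basis elements lie in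
  \<open>\<int>[golden]\<close>. Cartan coefficients of unit complex numbers are such traces.\<close>

lemma twice_Re_OH2:
  assumes "z \<in> OH2"
  shows "2 * Re z \<in> int_adjoin golden"
proof -
  obtain a b c d where z: "z = zeta10_comb a b c d" using assms by (elim OH2_coords)
  have "z + cnj z = 2 * of_int a + of_int b * (zeta10 + cnj zeta10)
      + of_int c * (zeta10\<^sup>2 + (cnj zeta10)\<^sup>2) + of_int d * (zeta10 ^ 3 + (cnj zeta10) ^ 3)"
    by (simp add: z zeta10_comb_def algebra_simps)
  then have "z + cnj z = of_int (2 * a - c + d) + of_int (b + c - d) * of_real golden"
    unfolding zeta10_trace zeta10_power_traces by (simp add: algebra_simps)
  then have "of_real (2 * Re z) = (of_real (of_int (2 * a - c + d) + of_int (b + c - d) * golden) :: complex)"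
    by (simp add: complex_add_cnj)
  then have "2 * Re z = of_int (2 * a - c + d) + of_int (b + c - d) * golden"
    by (simp only: of_real_eq_iff)
  then show ?thesis using int_adjoin_linear by metis
qed

lemma norm_tenth_root: "z ^ 10 = 1 \<Longrightarrow> norm (z :: complex) = 1"
  using power_eq_imp_eq_norm[of z 10 1] by simp

text \<open>The tenth roots of unity form a group that is closed under conjugation and, as \<open>10\<close> is even,
  under negation. It lies in \<open>OH2\<close>, where traces are elements of \<open>\<int>[golden]\<close>.\<close>

lemma root_shell_system_decagon: "root_shell_system (int_adjoin golden) {z :: complex. z ^ 10 = 1}"
proof -
  let ?T = "{z :: complex. z ^ 10 = 1}"
  have neg: "- z \<in> ?T" if "z \<in> ?T" for z using that by simp
  have refl: "root_reflection a x \<in> ?T" if "a \<in> ?T" "x \<in> ?T" for a x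
  proof -
    have "(a\<^sup>2 * cnj x) ^ 10 = (a ^ 10)\<^sup>2 * cnj (x ^ 10)"
      by (simp add: power_mult_distrib flip: power_mult)
    then have "(a\<^sup>2 * cnj x) ^ 10 = 1" using that by (simp only: mem_Collect_eq complex_cnj_one mult_1 power_one)
    then show ?thesis
      using that by (simp add: root_reflection_unit_complex norm_tenth_root)
  qed
  have invol: "root_reflection a (root_reflection a x) = x" if "a \<in> ?T" for a x
  proof -
    have "a * cnj a = 1"
      using that by (simp add: complex_norm_square[symmetric] norm_tenth_root)
    then show ?thesis
      using that by (simp add: root_reflection_unit_complex norm_tenth_root flip: mult.assoc power_mult_distrib)
  qed
  show ?thesis
    unfolding root_shell_system_def
  proof (intro conjI ballI)
    show "real_subring (int_adjoin golden)" by (rule real_subring_int_adjoin)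
    show "finite ?T" by (rule finite_roots_unity) simp
    show "uminus ` ?T = ?T"
    proof (intro equalityI subsetI)
      fix x assume "x \<in> ?T"
      then show "x \<in> uminus ` ?T" using neg by (intro image_eqI[of x uminus "- x"]) auto
    qed (use neg in blast)
  next
    fix a assume "a \<in> ?T"
    then show "(norm a)\<^sup>2 = 1" by (simp add: norm_tenth_root)
  next
    fix a assume a: "a \<in> ?T"
    show "root_reflection a ` ?T = ?T"
    proof (intro equalityI subsetI)
      fix x assume "x \<in> ?T"
      then show "x \<in> root_reflection a ` ?T"
        using refl[OF a] invol[OF a] by (intro image_eqI[of x _ "root_reflection a x"]) auto
    qed (use refl a in blast)
  next
    fix a b assume ab: "a \<in> ?T" "b \<in> ?T"
    have "(a * cnj b) ^ 10 = a ^ 10 * cnj (b ^ 10)"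
      by (simp add: power_mult_distrib)
    then have "(a * cnj b) ^ 10 = 1"
      using ab by (simp only: mem_Collect_eq complex_cnj_one mult_1)
    then have "a * cnj b \<in> unit_shell OH2" by (simp add: unit_shell_OH2)
    then have "2 * Re (a * cnj b) \<in> int_adjoin golden"
      by (intro twice_Re_OH2) (simp add: unit_shell_def)
    moreover have "cartan_coeff a b = 2 * Re (a * cnj b)"
      using ab by (simp add: cartan_coeff_def norm_tenth_root flip: power2_norm_eq_inner)
        (simp add: inner_complex_def)
    ultimately show "cartan_coeff a b \<in> int_adjoin golden" by simp
  qed
qed

lemma cartan_coeff_zeta10: "cartan_coeff (1, 0) (zeta10, 0 :: complex) = golden"
proof -
  have "of_real (2 * Re zeta10) = (of_real golden :: complex)"
    using zeta10_trace by (simp add: complex_add_cnj)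
  then have "2 * Re zeta10 = golden" by (simp only: of_real_eq_iff)
  then show ?thesis by (simp add: cartan_coeff_def inner_complex_def)
qed

lemma noncrystallographic_axis_shell: "noncrystallographic_root_shell_system (axis_shell OH2)"
proof -
  have "root_shell_system (int_adjoin golden) (axis_shell OH2)"
    unfolding axis_shell_def unit_shell_OH2
    by (intro root_shell_system_axis_sum root_shell_system_decagon)
  moreover have "(1, 0) \<in> axis_shell OH2" "(zeta10, 0) \<in> axis_shell OH2"
    using zeta10_power_eq_1_iff[of 10] by (auto simp: axis_shell_def axis_sum_def unit_shell_OH2)
  ultimately show ?thesis
    unfolding noncrystallographic_root_shell_system_def
    using cartan_coeff_zeta10 golden_notin_Ints by metis
qed

section \<open>The reflection group of the decagon\<close>

lemma mult_BijGroup_UNIV: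
  "f \<in> carrier (BijGroup UNIV) \<Longrightarrow> g \<in> carrier (BijGroup UNIV) \<Longrightarrow> f \<otimes>\<^bsub>BijGroup UNIV\<^esub> g = f \<circ> g"
  by (simp add: BijGroup_def compose_def fun_eq_iff)

lemma one_BijGroup_UNIV: "\<one>\<^bsub>BijGroup UNIV\<^esub> = id"
  by (simp add: BijGroup_def fun_eq_iff)

lemma carrier_BijGroup_UNIV: "f \<in> carrier (BijGroup UNIV) \<longleftrightarrow> bij f"
  by (simp add: BijGroup_def Bij_def)

lemma pow_BijGroup_UNIV:
  assumes "bij f"
  shows "f [^]\<^bsub>BijGroup UNIV\<^esub> (n::nat) = f ^^ n"
proof (induction n)
  case 0
  show ?case by (simp add: one_BijGroup_UNIV)
next
  case (Suc n)
  interpret group "BijGroup UNIV" by (rule group_BijGroup)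
  have "bij (f ^^ n)" using assms by (rule bij_fn)
  then have "f [^]\<^bsub>BijGroup UNIV\<^esub> Suc n = (f ^^ n) \<circ> f"
    using assms Suc by (simp add: mult_BijGroup_UNIV carrier_BijGroup_UNIV)
  then show ?case by (simp only: funpow_Suc_right)
qed

lemma ord_BijGroup_UNIV_eqI:
  assumes "bij f" "\<And>n. f ^^ n = id \<longleftrightarrow> d dvd n"
  shows "group.ord (BijGroup UNIV) f = d"
  using group.ord_unique[OF group_BijGroup, of f UNIV d] assms
  by (simp add: carrier_BijGroup_UNIV pow_BijGroup_UNIV one_BijGroup_UNIV)

lemma ord_involution:
  assumes "f \<circ> f = id" "f \<noteq> id"
  shows "group.ord (BijGroup UNIV) f = 2"
proof (rule ord_BijGroup_UNIV_eqI)
  show "bij f" using assms(1) by (metis o_bij)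
  fix n :: nat
  have f2: "f ^^ 2 = id" using assms(1) by (simp add: numeral_2_eq_2)
  have ev: "f ^^ (2 * k) = id" for k
  proof -
    have "f ^^ (2 * k) = (f ^^ 2) ^^ k" by (simp only: funpow_mult mult.commute)
    then show ?thesis by (simp add: f2)
  qed
  show "f ^^ n = id \<longleftrightarrow> 2 dvd n"
  proof (cases "even n")
    case True
    then show ?thesis using ev by (auto elim: evenE)
  next
    case False
    then obtain k where "n = Suc (2 * k)" by (auto elim: oddE)
    then have "f ^^ n = f" by (simp add: ev)
    then show ?thesis using False assms(2) by simp
  qed
qed

lemma funpow_mult_left: "((*) c ^^ n) = (*) (c ^ n)" for c :: "'a::comm_monoid_mult"
  by (induction n) (auto simp: fun_eq_iff mult_ac)

text \<open>The reflections \<open>s\<close> in \<open>zeta10\<close> and \<open>t\<close> in \<open>1\<close> compose to multiplication by \<open>zeta10\<^sup>2\<close>, a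
  primitive fifth root of unity. Composing the reflection in \<open>zeta10 ^ k\<close> with \<open>s \<circ> t\<close> gives the one
  in \<open>zeta10 ^ (k + 1)\<close>, so \<open>s\<close> and \<open>t\<close> generate all of them.\<close>

lemma dihedral_decagon: "dihedral_coxeter 5 (reflection_group {z :: complex. z ^ 10 = 1})"
proof -
  let ?T = "{z :: complex. z ^ 10 = 1}" and ?G = "BijGroup (UNIV :: complex set)"
  interpret group ?G by (rule group_BijGroup)
  define s where "s = root_reflection zeta10"
  define t where "t = root_reflection (1::complex)"
  have refl: "root_reflection (zeta10 ^ k) = (\<lambda>x. - (zeta10 ^ (2 * k) * cnj x))" for k
  proof -
    have "(zeta10 ^ k)\<^sup>2 = zeta10 ^ (2 * k)" by (metis power_mult mult.commute)
    then show ?thesis by (simp add: fun_eq_iff root_reflection_unit_complex norm_power)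
  qed
  have s: "s = (\<lambda>x. - (zeta10\<^sup>2 * cnj x))" using refl[of 1] by (simp add: s_def)
  have t: "t = (\<lambda>x. - cnj x)" using refl[of 0] by (simp add: t_def)
  have unit2: "zeta10\<^sup>2 * (cnj zeta10)\<^sup>2 = 1"
    using zeta10_cnj by (simp flip: power_mult_distrib)
  have ss: "s \<circ> s = id" 
  proof
    fix x
    have "(s \<circ> s) x = (zeta10\<^sup>2 * (cnj zeta10)\<^sup>2) * x" by (simp add: s)
    then show "(s \<circ> s) x = id x" by (simp add: unit2)
  qed
  have tt: "t \<circ> t = id" by (auto simp: t)
  have st: "s \<circ> t = (*) (zeta10\<^sup>2)" by (auto simp: s t)
  have "s \<noteq> id"
  proof
    assume "s = id"
    then have "s zeta10 = zeta10" by simp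
    moreover have "s zeta10 = - zeta10"
      using zeta10_cnj by (simp add: s power2_eq_square mult.assoc)
    ultimately show False using norm_zeta10 by auto
  qed
  moreover have "t \<noteq> id"
  proof
    assume "t = id"
    then have "t 1 = 1" by simp
    then show False by (simp add: t)
  qed
  ultimately have ord: "group.ord ?G s = 2" "group.ord ?G t = 2"
    using ss tt by (auto intro: ord_involution)
  have bij: "bij s" "bij t" using ss tt by (auto intro: o_bij)
  then have carr: "s \<in> carrier ?G" "t \<in> carrier ?G" by (auto simp: carrier_BijGroup_UNIV)
  have "group.ord ?G (s \<circ> t) = 5"
  proof (rule ord_BijGroup_UNIV_eqI)
    show "bij (s \<circ> t)" using bij by (simp add: bij_comp)
    fix n :: nat
    have "(s \<circ> t) ^^ n = (*) (zeta10 ^ (2 * n))"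
      unfolding st funpow_mult_left by (simp add: power_mult)
    moreover have "(*) c = id \<longleftrightarrow> c = 1" for c :: complex
      by (metis eq_id_iff mult_1 mult.right_neutral)
    moreover have "10 dvd 2 * n \<longleftrightarrow> 5 dvd n" by presburger
    ultimately show "(s \<circ> t) ^^ n = id \<longleftrightarrow> 5 dvd n"
      by (simp add: zeta10_power_eq_1_iff)
  qed
  then have ord5: "group.ord ?G (s \<otimes>\<^bsub>?G\<^esub> t) = 5" using carr by (simp add: mult_BijGroup_UNIV)
  have sub: "{s, t} \<subseteq> root_reflection ` ?T"
    using zeta10_power_eq_1_iff[of 10] by (auto simp: s_def t_def)
  let ?W = "generate ?G {s, t}"
  have gen: "root_reflection (zeta10 ^ k) \<in> ?W" for k
  proof (induction k)
    case 0
    show ?case by (simp add: t_def[symmetric] generate.incl)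
  next
    case (Suc k)
    have "s \<otimes>\<^bsub>?G\<^esub> t \<in> ?W" by (intro generate.eng generate.incl) auto
    then have mem: "(s \<otimes>\<^bsub>?G\<^esub> t) \<otimes>\<^bsub>?G\<^esub> root_reflection (zeta10 ^ k) \<in> ?W"
      using Suc by (rule generate.eng)
    have "{s, t} \<subseteq> carrier ?G" using carr by simp
    then have rk: "root_reflection (zeta10 ^ k) \<in> carrier ?G"
      by (rule generate_in_carrier[OF _ Suc])
    have "s \<circ> t \<in> carrier ?G"
      using bij by (simp only: carrier_BijGroup_UNIV bij_comp)
    then have "(s \<otimes>\<^bsub>?G\<^esub> t) \<otimes>\<^bsub>?G\<^esub> root_reflection (zeta10 ^ k) = (s \<circ> t) \<circ> root_reflection (zeta10 ^ k)"
      using carr rk by (simp only: mult_BijGroup_UNIV)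
    also have "\<dots> = root_reflection (zeta10 ^ Suc k)"
    proof -
      have "zeta10 ^ (2 * Suc k) = zeta10\<^sup>2 * zeta10 ^ (2 * k)" by (simp add: power2_eq_square)
      then show ?thesis unfolding st refl by (simp only: fun_eq_iff o_apply mult_minus_right mult.assoc simp_thms)
    qed
    finally show ?case using mem by simp
  qed
  have all: "root_reflection ` ?T \<subseteq> ?W"
    unfolding zeta10_powers_eq_roots[symmetric] using gen by auto
  have "generate ?G (root_reflection ` ?T) = ?W"
  proof
    have "subgroup ?W ?G" using carr by (intro generate_is_subgroup) auto
    then show "generate ?G (root_reflection ` ?T) \<subseteq> ?W"
      by (rule generate_subgroup_incl[OF all])
  qed (rule mono_generate[OF sub])
  then show ?thesis
    unfolding dihedral_coxeter_def reflection_group_def using carr ord ord5 by blast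
qed

lemma decagon_vertices: "regular_polygon_vertices 10 = {z. z ^ 10 = 1}"
  using bij_betw_imp_surj_on[OF Complex.bij_betw_roots_unity[of 10]]
  by (simp add: regular_polygon_vertices_def)

lemma is_H2_decagon: "is_H2 {z. z ^ 10 = 1}"
  unfolding is_H2_def decagon_vertices using dihedral_decagon
  by (auto intro: exI[of _ id] simp: orthogonal_transformation_id[unfolded id_def[symmetric]])

section \<open>The convex hull\<close>

lemma tegum_convex_hulls: "tegum (convex hull A) (convex hull B) = convex hull (axis_sum A B)"
proof -
  have "axis_sum (convex hull A) (convex hull B)
      = (convex hull (A \<times> {0})) \<union> (convex hull ({0} \<times> B))"
    by (simp add: axis_sum_def convex_hull_Times)
  also have "\<dots> \<subseteq> convex hull (axis_sum A B)"
    by (simp add: axis_sum_def hull_mono)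
  finally have 1: "tegum (convex hull A) (convex hull B) \<subseteq> convex hull (axis_sum A B)"
    unfolding tegum_def by (simp add: hull_minimal)
  have "axis_sum A B \<subseteq> axis_sum (convex hull A) (convex hull B)"
    using hull_subset[of A convex] hull_subset[of B convex] by (auto simp: axis_sum_def)
  then show ?thesis
    using 1 unfolding tegum_def by (simp add: hull_mono subset_antisym)
qed

theorem theorem5p1:
  shows "unit_shell OH2 = {zeta10 ^ k | k :: nat. 0 \<le> k \<and> k \<le> 9} \<and>
    is_H2 (unit_shell OH2) \<and>
    card (unit_shell OH2) = 10 \<and>
    axis_shell OH2 = plane_unit_shell OH2 \<and>
    noncrystallographic_root_shell_system (axis_shell OH2) \<and>
    is_H2_plus_H2 (axis_shell OH2) \<and>
    card (axis_shell OH2) = 20 \<and>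
    convex hull (axis_shell OH2) = tegum (regular_polygon 10) (regular_polygon 10)"
proof (intro conjI)
  have "0 \<le> k \<and> k \<le> 9 \<longleftrightarrow> k < 10" for k :: nat by auto
  then show "unit_shell OH2 = {zeta10 ^ k | k :: nat. 0 \<le> k \<and> k \<le> 9}"
    by (simp only: unit_shell_OH2 zeta10_powers_eq_roots)
  show "is_H2 (unit_shell OH2)"
    by (simp add: unit_shell_OH2 is_H2_decagon)
  then show "is_H2_plus_H2 (axis_shell OH2)"
    by (auto simp: is_H2_plus_H2_def axis_shell_def)
  show c: "card (unit_shell OH2) = 10"
    unfolding unit_shell_OH2 by (rule card_roots_unity_eq) simp
  then have "finite (unit_shell OH2)" by (simp add: card_ge_0_finite)
  moreover have "0 \<notin> unit_shell OH2" by (simp add: unit_shell_def N_def)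
  ultimately show "card (axis_shell OH2) = 20"
    by (simp add: axis_shell_def card_axis_sum c)
  show "axis_shell OH2 = plane_unit_shell OH2"
    by (rule axis_shell_eq_plane_unit_shell)
  show "noncrystallographic_root_shell_system (axis_shell OH2)"
    by (rule noncrystallographic_axis_shell)
  show "convex hull (axis_shell OH2) = tegum (regular_polygon 10) (regular_polygon 10)"
    unfolding regular_polygon_def decagon_vertices tegum_convex_hulls
    by (simp add: axis_shell_def unit_shell_OH2)
qed

end
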